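(* Let $k\in\mathbb{N}$. The equation $$x^4+y^2+z^2+2yz=kx^2yz$$ has positive integer solutions if and only if $k=1,2,5$. For $k=1$, there are exactly two orbits of positive integer solutions: $\Gamma[(3,6,3)]$ and $\Gamma[(3,3,6)]$. For $k=2$ and $k=5$, there is only one orbit of positive integer solutions: $\Gamma[(2,2,2)]$ and $\Gamma[(1,1,1)]$, respectively.
   Context: $\mathbb{N}$ denotes the non-negative integers. $\Gamma=\langle\mu_1,\mu_2,\mu_3\rangle$ is the group of transformations of $\mathbb{Q}_+^3$ (triples of positive rationals) generated by the involutions $$\mu_1(x,y,z)=\left(\frac{y+z}{x},y,z\right),\quad \mu_2(x,y,z)=\left(x,\frac{x^4+z^2}{y},z\right),\quad \mu_3(x,y,z)=\left(x,y,\frac{x^4+y^2}{z}\right),$$ and $\Gamma[p]$ denotes the $\Gamma$-orbit of $p$. The statement says that the set of positive integer solutions is the union of the listed orbits. *)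

theory Defs
  imports Complex_Main "HOL-Algebra.Group_Action" "HOL-Algebra.Elementary_Groups"
begin

definition Qpos3 :: "(rat \<times> rat \<times> rat) set" where
  "Qpos3 = {(x, y, z). 0 < x \<and> 0 < y \<and> 0 < z}"

(* Elements of BijGroup are extensional functions, hence the restrictions. *)

definition mu1 :: "rat \<times> rat \<times> rat \<Rightarrow> rat \<times> rat \<times> rat" where
  "mu1 = restrict (\<lambda>(x, y, z). ((y + z) / x, y, z)) Qpos3"

definition mu2 :: "rat \<times> rat \<times> rat \<Rightarrow> rat \<times> rat \<times> rat" where
  "mu2 = restrict (\<lambda>(x, y, z). (x, (x ^ 4 + z ^ 2) / y, z)) Qpos3"

definition mu3 :: "rat \<times> rat \<times> rat \<Rightarrow> rat \<times> rat \<times> rat" where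
  "mu3 = restrict (\<lambda>(x, y, z). (x, y, (x ^ 4 + y ^ 2) / z)) Qpos3"

(* subgroup_generated G A only uses the elements of A in carrier G;
   mu_in_carrier below shows that no generator is dropped. *)

definition Gam :: "(rat \<times> rat \<times> rat \<Rightarrow> rat \<times> rat \<times> rat) monoid" where
  "Gam = subgroup_generated (BijGroup Qpos3) {mu1, mu2, mu3}"

definition Gam_orbit :: "rat \<times> rat \<times> rat \<Rightarrow> (rat \<times> rat \<times> rat) set" where
  "Gam_orbit p = orbit Gam (\<lambda>g. g) p"

(* The solutions are integral, but are viewed as points of Qpos3. *)

definition pos_int_solutions :: "nat \<Rightarrow> (rat \<times> rat \<times> rat) set" where
  "pos_int_solutions k =
     {(of_int x, of_int y, of_int z) | x y z :: int.
        0 < x \<and> 0 < y \<and> 0 < z \<and>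
        x ^ 4 + y ^ 2 + z ^ 2 + 2 * y * z = int k * x ^ 2 * y * z}"

lemma involution_in_Bij:
  assumes "f \<in> extensional S" "\<And>p. p \<in> S \<Longrightarrow> f p \<in> S" "\<And>p. p \<in> S \<Longrightarrow> f (f p) = p"
  shows "f \<in> Bij S"
  using assms by (auto simp: Bij_def intro: bij_betwI[where g = f])

lemma mu_closed:
  assumes "p \<in> Qpos3"
  shows "mu1 p \<in> Qpos3" "mu2 p \<in> Qpos3" "mu3 p \<in> Qpos3"
  using assms by (auto simp: Qpos3_def mu1_def mu2_def mu3_def intro!: divide_pos_pos add_pos_pos)

lemma mu_involution:
  assumes "p \<in> Qpos3"
  shows "mu1 (mu1 p) = p" "mu2 (mu2 p) = p" "mu3 (mu3 p) = p"
proof -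
  obtain x y z where p: "p = (x, y, z)" "0 < x" "0 < y" "0 < z"
    using assms by (auto simp: Qpos3_def)
  have pos: "0 < y + z" "0 < x ^ 4 + z ^ 2" "0 < x ^ 4 + y ^ 2"
    using p by (auto intro!: add_pos_pos)
  have q: "((y + z) / x, y, z) \<in> Qpos3" "(x, (x ^ 4 + z ^ 2) / y, z) \<in> Qpos3"
    "(x, y, (x ^ 4 + y ^ 2) / z) \<in> Qpos3"
    using p pos by (auto simp: Qpos3_def)
  show "mu1 (mu1 p) = p" using assms p q pos by (simp add: mu1_def)
  show "mu2 (mu2 p) = p" using assms p q pos by (simp add: mu2_def)
  show "mu3 (mu3 p) = p" using assms p q pos by (simp add: mu3_def)
qed

lemma mu_in_carrier: "{mu1, mu2, mu3} \<subseteq> carrier (BijGroup Qpos3)"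
proof -
  have "mu1 \<in> extensional Qpos3" "mu2 \<in> extensional Qpos3" "mu3 \<in> extensional Qpos3"
    by (simp_all add: mu1_def mu2_def mu3_def)
  then show ?thesis
    by (auto simp: BijGroup_def intro!: involution_in_Bij mu_closed mu_involution)
qed

lemma group_action_Gam: "group_action Gam Qpos3 (\<lambda>g. g)"
proof -
  have G: "group (BijGroup Qpos3)" by (rule group_BijGroup)
  then have "group Gam"
    unfolding Gam_def by (rule group.group_subgroup_generated)
  moreover have "(\<lambda>g. g) \<in> hom Gam (BijGroup Qpos3)"
    using group.carrier_subgroup_generated_subset[of "BijGroup Qpos3" "{mu1, mu2, mu3}"] G
    by (auto simp: hom_def Gam_def)
  ultimately show ?thesis
    using G by (simp add: group_action_def group_hom_def group_hom_axioms_def)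
qed

end

theory Submission
  imports Defs
begin

(* Vieta descent: each generator maps integral solutions to integral solutions, so every orbit
   contains a solution minimal under the three moves, i.e. with x^2 <= y + z,
   y^2 <= x^4 + z^2 and z^2 <= x^4 + y^2.  If y > z, put t = x^4, A = y^2 - z^2, S = (y + z)^2;
   then A <= t <= S, and since (t + S)^2 / t decreases on t <= S, the equation
   t + S = k x^2 y z yields k^2 z^2 (y - z) <= 4 (y + z), which leaves finitely many cases.
   For k = 1 the two orbits are separated by the residues of y and z modulo 9. *)

section \<open>Integral solutions and the three Vieta moves\<close>

definition sol :: "int \<Rightarrow> int \<Rightarrow> int \<Rightarrow> int \<Rightarrow> bool" where
  "sol k x y z \<longleftrightarrow> 0 < x \<and> 0 < y \<and> 0 < z \<and> x ^ 4 + (y + z) ^ 2 = k * x ^ 2 * y * z"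

text \<open>Solutions stay integers, where divisibility and congruences make sense, and enter
  \<open>Qpos3\<close> only through this cast.\<close>

definition pt :: "int \<Rightarrow> int \<Rightarrow> int \<Rightarrow> rat \<times> rat \<times> rat" where
  "pt x y z = (of_int x, of_int y, of_int z)"

lemma pt_in_Qpos3: "0 < x \<Longrightarrow> 0 < y \<Longrightarrow> 0 < z \<Longrightarrow> pt x y z \<in> Qpos3"
  by (simp add: pt_def Qpos3_def)

lemma pos_int_solutions_iff:
  "p \<in> pos_int_solutions k \<longleftrightarrow> (\<exists>x y z. p = pt x y z \<and> sol (int k) x y z)"
  by (auto simp: pos_int_solutions_def pt_def sol_def power2_eq_square algebra_simps)

lemma sol_swap: "sol k x y z \<longleftrightarrow> sol k x z y"
  by (auto simp: sol_def algebra_simps)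

text \<open>As a quadratic in \<open>x ^ 2\<close> the equation has root sum
  \<open>k * y * z\<close> and root product \<open>(y + z) ^ 2\<close>. Integrality of the new
  coordinate comes from \<open>x ^ 2 dvd (y + z) ^ 2\<close>, which forces
  \<open>x dvd y + z\<close>. The root sum is exported for the later congruence argument.\<close>

lemma sol_mu1:
  assumes "sol k x y z"
  obtains x' where "x * x' = y + z" "x ^ 2 + x' ^ 2 = k * y * z" "sol k x' y z"
    "mu1 (pt x y z) = pt x' y z"
proof -
  have s: "0 < x" "0 < y" "0 < z" and e: "x ^ 4 + (y + z) ^ 2 = k * x ^ 2 * y * z"
    using assms by (auto simp: sol_def)
  have "(y + z) ^ 2 = x ^ 2 * (k * y * z - x ^ 2)"
    using e by (simp add: algebra_simps power4_eq_xxxx power2_eq_square)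
  then have "x ^ 2 dvd (y + z) ^ 2" by simp
  then have "x dvd y + z" by simp
  then obtain x' where x': "y + z = x * x'" ..
  have "0 < x * x'" using s by (simp flip: x')
  then have x'pos: "0 < x'" using s(1) by (rule zero_less_mult_pos)
  have "x ^ 2 * (x ^ 2 + x' ^ 2) = x ^ 2 * (k * y * z)"
    using e unfolding x' by (simp add: algebra_simps power4_eq_xxxx power2_eq_square)
  then have q: "x ^ 2 + x' ^ 2 = k * y * z" using s by simp
  have "x' ^ 4 + (x * x') ^ 2 = x' ^ 2 * (x ^ 2 + x' ^ 2)"
    by (simp add: algebra_simps power4_eq_xxxx power2_eq_square)
  then have "sol k x' y z" using s x'pos x' unfolding q by (simp add: sol_def)
  moreover have "(of_int y + of_int z :: rat) / of_int x = of_int x'"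
    using s by (simp flip: of_int_add add: x')
  then have "mu1 (pt x y z) = pt x' y z"
    using pt_in_Qpos3[OF s] by (simp add: mu1_def pt_def)
  ultimately show thesis using that x'[symmetric] q by blast
qed

text \<open>Vieta for the quadratic in \<open>y\<close>: the root sum
  \<open>k * x ^ 2 * z - 2 * z\<close> shows that the other root is an integer, and the root product
  \<open>x ^ 4 + z ^ 2\<close> identifies it with the value of \<open>mu2\<close>.\<close>

lemma sol_mu2:
  assumes "sol k x y z"
  obtains y' where "y' = k * x ^ 2 * z - 2 * z - y" "y * y' = x ^ 4 + z ^ 2" "sol k x y' z"
    "mu2 (pt x y z) = pt x y' z"
proof -
  have s: "0 < x" "0 < y" "0 < z" and e: "x ^ 4 + (y + z) ^ 2 = k * x ^ 2 * y * z"
    using assms by (auto simp: sol_def)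
  define y' where "y' = k * x ^ 2 * z - 2 * z - y"
  have y': "y * y' = x ^ 4 + z ^ 2"
    using e by (simp add: y'_def algebra_simps power2_eq_square)
  have "0 < y * y'" unfolding y' using s by (simp add: add_pos_pos)
  then have y'pos: "0 < y'" using s(2) by (rule zero_less_mult_pos)
  \<comment> \<open>Multiplying the root sum by \<open>y'\<close> and inserting the root product
    yields the equation for \<open>y'\<close>.\<close>
  have "k * x ^ 2 * z = y + y' + 2 * z" by (simp add: y'_def)
  then have "k * x ^ 2 * y' * z = (y + y' + 2 * z) * y'" by (simp add: mult.assoc mult.left_commute)
  also have "\<dots> = y * y' + y' ^ 2 + 2 * y' * z" by (simp add: algebra_simps power2_eq_square)
  also have "\<dots> = x ^ 4 + (y' + z) ^ 2" unfolding y' by (simp add: algebra_simps power2_eq_square)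
  finally have "sol k x y' z" using s y'pos by (simp add: sol_def)
  moreover have "(of_int x ^ 4 + of_int z ^ 2 :: rat) / of_int y = of_int y'"
    using s by (simp flip: of_int_add of_int_power y')
  then have "mu2 (pt x y z) = pt x y' z"
    using pt_in_Qpos3[OF s] by (simp add: mu2_def pt_def)
  ultimately show thesis using that y' y'_def by blast
qed

lemma sol_mu3:
  assumes "sol k x y z"
  obtains z' where "z' = k * x ^ 2 * y - 2 * y - z" "z * z' = x ^ 4 + y ^ 2" "sol k x y z'"
    "mu3 (pt x y z) = pt x y z'"
proof -
  have s: "0 < x" "0 < y" "0 < z" using assms by (auto simp: sol_def)
  have "sol k x z y" using assms by (simp add: sol_swap)
  then obtain z' where z': "z' = k * x ^ 2 * y - 2 * y - z" "z * z' = x ^ 4 + y ^ 2" "sol k x z' y"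
    by (rule sol_mu2)
  have "(of_int x ^ 4 + of_int y ^ 2 :: rat) / of_int z = of_int z'"
    using s by (simp flip: of_int_add of_int_power z'(2))
  then have "mu3 (pt x y z) = pt x y z'"
    using pt_in_Qpos3[OF s] by (simp add: mu3_def pt_def)
  moreover have "sol k x y z'" using z'(3) by (simp add: sol_swap)
  ultimately show thesis using that z' by blast
qed

section \<open>The generated group and its orbits\<close>

lemma carrier_Gam: "carrier Gam = generate (BijGroup Qpos3) {mu1, mu2, mu3}"
  using mu_in_carrier by (simp add: Gam_def carrier_subgroup_generated Int_absorb1)

lemma inv_BijGroup_involution:
  assumes "f \<in> carrier (BijGroup S)" "\<And>p. p \<in> S \<Longrightarrow> f (f p) = p"
  shows "inv\<^bsub>BijGroup S\<^esub> f = f"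
proof (rule group.inv_equality[OF group_BijGroup])
  show "f \<otimes>\<^bsub>BijGroup S\<^esub> f = \<one>\<^bsub>BijGroup S\<^esub>"
    using assms by (auto simp: BijGroup_def compose_def)
qed (use assms in auto)

text \<open>Closure under the three generators suffices: each is its own inverse, so inverses of
  generators bring nothing new. Since \<open>T\<close> lies in \<open>Qpos3\<close>, the unit and
  the products of \<open>BijGroup\<close> act on \<open>T\<close> as the plain identity and
  composition.\<close>

lemma Gam_orbit_subset:
  assumes "p \<in> T" "T \<subseteq> Qpos3"
    and closed: "\<And>q. q \<in> T \<Longrightarrow> mu1 q \<in> T \<and> mu2 q \<in> T \<and> mu3 q \<in> T"
  shows "Gam_orbit p \<subseteq> T"
proof -
  have "g q \<in> T" if "g \<in> generate (BijGroup Qpos3) {mu1, mu2, mu3}" "q \<in> T" for g q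
    using that
  proof (induction arbitrary: q rule: generate.induct)
    case one
    then show ?case using assms by (auto simp: BijGroup_def)
  next
    case (incl h)
    then show ?case using closed by blast
  next
    case (inv h)
    have "inv\<^bsub>BijGroup Qpos3\<^esub> h = h"
      using inv mu_in_carrier by (intro inv_BijGroup_involution) (auto simp: mu_involution)
    then show ?case using inv closed by (metis empty_iff insert_iff)
  next
    case (eng h1 h2)
    have "h1 \<in> carrier (BijGroup Qpos3)" "h2 \<in> carrier (BijGroup Qpos3)"
      using eng group.generate_in_carrier[OF group_BijGroup mu_in_carrier] by auto
    then show ?case using eng assms(2) by (auto simp: BijGroup_def compose_def)
  qed
  then show ?thesis using assms(1) unfolding Gam_orbit_def orbit_def carrier_Gam by blast
qed

lemma Gam_orbit_eq:
  assumes "p \<in> Qpos3" "q \<in> Gam_orbit p"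
  shows "Gam_orbit q = Gam_orbit p"
proof -
  interpret group_action Gam Qpos3 "\<lambda>g. g" by (rule group_action_Gam)
  obtain g where g: "g \<in> carrier Gam" "q = g p"
    using assms(2) by (force simp: Gam_orbit_def orbit_def)
  have q: "q \<in> Qpos3" using element_image[OF g(1) assms(1)] g(2) by metis
  have qp: "q \<in> orbit Gam (\<lambda>g. g) p" using assms(2) by (simp add: Gam_orbit_def)
  have sub: "orbit Gam (\<lambda>g. g) a \<subseteq> orbit Gam (\<lambda>g. g) b"
    if "a \<in> Qpos3" "b \<in> Qpos3" "a \<in> orbit Gam (\<lambda>g. g) b" for a b
  proof
    fix c assume c: "c \<in> orbit Gam (\<lambda>g. g) a"
    then obtain h where h: "h \<in> carrier Gam" "h a = c" by (force simp: orbit_def)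
    have "c \<in> Qpos3" using element_image[OF h(1) that(1) h(2)] .
    then show "c \<in> orbit Gam (\<lambda>g. g) b" using orbit_trans that c by metis
  qed
  show ?thesis unfolding Gam_orbit_def
    using sub[OF q assms(1) qp] sub[OF assms(1) q] orbit_sym[OF assms(1) q qp] by blast
qed

lemma mem_Gam_orbit: "p \<in> Qpos3 \<Longrightarrow> p \<in> Gam_orbit p"
  using group_action.orbit_refl[OF group_action_Gam] by (simp add: Gam_orbit_def)

lemma Gam_orbit_mu:
  assumes "p \<in> Qpos3" "m \<in> {mu1, mu2, mu3}"
  shows "Gam_orbit (m p) = Gam_orbit p"
proof (rule Gam_orbit_eq)
  have "m \<in> carrier Gam" unfolding carrier_Gam using assms(2) by (rule generate.incl)
  then show "m p \<in> Gam_orbit p" by (auto simp: Gam_orbit_def orbit_def)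
qed (use assms in auto)

lemma Gam_orbit_subset_solutions:
  assumes "p \<in> pos_int_solutions k"
  shows "Gam_orbit p \<subseteq> pos_int_solutions k"
proof (rule Gam_orbit_subset)
  show "pos_int_solutions k \<subseteq> Qpos3"
    by (auto simp: pos_int_solutions_def Qpos3_def)
  fix q assume "q \<in> pos_int_solutions k"
  then obtain x y z where "q = pt x y z" "sol (int k) x y z" by (auto simp: pos_int_solutions_iff)
  then show "mu1 q \<in> pos_int_solutions k \<and> mu2 q \<in> pos_int_solutions k \<and> mu3 q \<in> pos_int_solutions k"
    by (metis pos_int_solutions_iff sol_mu1 sol_mu2 sol_mu3)
qed fact

section \<open>Classification of the reduced solutions\<close>

lemma descent_bound:
  fixes k X y z :: int
  assumes "0 < X" "0 < z" "z < y" "0 < k"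
    and e: "X ^ 2 + (y + z) ^ 2 = k * X * y * z"
    and le: "X \<le> y + z" and ge: "y ^ 2 \<le> X ^ 2 + z ^ 2"
  shows "k ^ 2 * z * (y - z) \<le> 14"
proof -
  define A where "A = y ^ 2 - z ^ 2"
  define S where "S = (y + z) ^ 2"
  define t where "t = X ^ 2"
  have A_eq: "A = (y - z) * (y + z)" by (simp add: A_def algebra_simps power2_eq_square)
  have Apos: "0 < A" using assms by (simp add: A_eq)
  have "A \<le> t" using ge by (simp add: A_def t_def)
  have "t \<le> S" unfolding t_def S_def using assms by (intro power_mono) auto
  have "t * A \<le> S * S"
    using Apos \<open>A \<le> t\<close> \<open>t \<le> S\<close> by (intro mult_mono) auto
  \<comment> \<open>This product equals \<open>(A + S) ^ 2 * t - (t + S) ^ 2 * A\<close>, so its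
    sign compares \<open>(t + S) ^ 2 / t\<close> with its value at \<open>t = A\<close> without any
    division.\<close>
  then have "0 \<le> (t - A) * (S * S - t * A)" using \<open>A \<le> t\<close> by simp
  then have "(t + S) ^ 2 * A \<le> (A + S) ^ 2 * t"
    by (simp add: algebra_simps power2_eq_square)
  moreover have "t + S = k * X * y * z" using e by (simp add: t_def S_def)
  moreover have "A + S = 2 * y * (y + z)"
    by (simp add: A_def S_def algebra_simps power2_eq_square)
  ultimately have "(k * X * y * z) ^ 2 * A \<le> (2 * y * (y + z)) ^ 2 * X ^ 2" by (simp add: t_def)
  then have "(X ^ 2 * y ^ 2 * (y + z)) * ((k * z) ^ 2 * (y - z)) \<le> (X ^ 2 * y ^ 2 * (y + z)) * (4 * (y + z))"
    by (simp add: A_eq power2_eq_square algebra_simps)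
  moreover have "0 < X ^ 2 * y ^ 2 * (y + z)" using assms by simp
  ultimately have main: "(k * z) ^ 2 * (y - z) \<le> 4 * (y + z)"
    by (simp only: mult_le_cancel_left_pos)
  \<comment> \<open>The arithmetic-geometric mean inequality on the left side of the equation gives
    \<open>2 * (y + z) \<le> k * y * z\<close>, hence \<open>k * z > 2\<close>.\<close>
  have "0 \<le> (X - (y + z)) ^ 2" by simp
  then have "2 * (X * (y + z)) \<le> X * (k * y * z)"
    using e by (simp add: algebra_simps power2_eq_square)
  then have "X * (2 * (y + z)) \<le> X * (k * y * z)" by (simp add: algebra_simps)
  then have le': "2 * (y + z) \<le> k * y * z" using assms(1) by (simp only: mult_le_cancel_left_pos)
  have "0 < 2 * z" using assms by simp
  also have "2 * z \<le> k * y * z - 2 * y" using le' by simp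
  also have "\<dots> = (k * z - 2) * y" by (simp add: algebra_simps)
  finally have "0 < (k * z - 2) * y" .
  then have kz: "3 \<le> k * z" using assms by (simp add: zero_less_mult_iff)
  then have "3 ^ 2 \<le> (k * z) ^ 2" by (intro power_mono) auto
  then have "9 * (y - z) \<le> (k * z) ^ 2 * (y - z)" using assms by (intro mult_right_mono) auto
  \<comment> \<open>With P for \<open>(k * z) ^ 2 * (y - z)\<close> and
    \<open>y + z = (y - z) + 2 * z\<close>, nine times \<open>main\<close> reads 9 P \<le> 36 (y -
    z) + 72 z \<le> 4 P + 72 z. The final 14 is 72 div 5.\<close>
  with main have "5 * ((k * z) ^ 2 * (y - z)) \<le> 72 * z" by (simp add: algebra_simps)
  then have "z * (5 * (k ^ 2 * z * (y - z))) \<le> z * 72" by (simp add: power2_eq_square ac_simps)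
  then have "5 * (k ^ 2 * z * (y - z)) \<le> 72" using assms by (simp only: mult_le_cancel_left_pos)
  then show ?thesis by simp
qed

text \<open>The finite check, with \<open>d\<close> for \<open>y - z\<close>. Bounding
  \<open>d\<close> by \<open>14 div (k ^ 2 * z)\<close> keeps the search small. The ranges are lists
  that the simplifier unfolds; \<open>set_upto\<close> would turn them back into intervals.\<close>

lemma reduced_search:
  "\<forall>k\<in>set [1..3]. \<forall>z\<in>set [1..14]. \<forall>d\<in>set [1..14 div (k ^ 2 * z)].
    \<forall>x\<in>set [1..7]. x ^ 2 \<le> z + d + z \<longrightarrow>
      x ^ 4 + (z + d + z) ^ 2 = k * x ^ 2 * (z + d) * (z :: int) \<longrightarrow>
      k = 1 \<and> x = 3 \<and> d = 3 \<and> z = 3"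
  by (simp add: upto.simps[of 1] del: set_upto)

lemma reduced_gt:
  assumes "sol k x y z" "x ^ 2 \<le> y + z" "y ^ 2 \<le> x ^ 4 + z ^ 2" "z < y"
  shows "k = 1 \<and> x = 3 \<and> y = 6 \<and> z = 3"
proof -
  have s: "0 < x" "0 < y" "0 < z" and e: "x ^ 4 + (y + z) ^ 2 = k * x ^ 2 * y * z"
    using assms by (auto simp: sol_def)
  have "0 < x ^ 4 + (y + z) ^ 2" using s by (simp add: add_pos_pos)
  then have "0 < k * (x ^ 2 * y * z)" using e by (simp add: mult.assoc)
  moreover have "0 < x ^ 2 * y * z" using s by simp
  ultimately have k: "0 < k" by (metis zero_less_mult_pos2)
  define d where "d = y - z"
  have d: "0 < d" "y = z + d" using assms by (auto simp: d_def)
  have b: "k ^ 2 * z * d \<le> 14"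
    unfolding d_def
    by (rule descent_bound[of "x ^ 2"]) (use s k assms e in \<open>auto simp flip: power_mult\<close>)
  have "1 \<le> k ^ 2" "1 \<le> z" "1 \<le> d" using k s d by auto
  then have "k ^ 2 * 1 * 1 \<le> k ^ 2 * z * d" "1 * z * 1 \<le> k ^ 2 * z * d"
    by (intro mult_mono; simp)+
  then have bounds: "k ^ 2 \<le> 14" "z \<le> 14" using b by auto
  have "k \<le> 3"
  proof (rule ccontr)
    assume "\<not> k \<le> 3"
    then have "4 ^ 2 \<le> k ^ 2" by (intro power_mono) auto
    then show False using bounds by simp
  qed
  have kz: "0 < k ^ 2 * z" using k s by simp
  have dle: "d \<le> 14 div (k ^ 2 * z)"
    using zdiv_mono1[OF b kz]
    unfolding nonzero_mult_div_cancel_left[OF less_imp_neq[OF kz, symmetric]] .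
  have "d \<le> k ^ 2 * z * d" using kz d by simp
  then have "d \<le> 14" using b by simp
  \<comment> \<open>Here \<open>x ^ 2 \<le> 2 * z + d \<le> 42\<close>, which is below
    \<open>8 ^ 2\<close>.\<close>
  have "x \<le> 7"
  proof (rule ccontr)
    assume "\<not> x \<le> 7"
    then have "8 ^ 2 \<le> x ^ 2" by (intro power_mono) auto
    then show False using bounds \<open>d \<le> 14\<close> assms(2) d by simp
  qed
  have mem: "k \<in> set [1..3]" "z \<in> set [1..14]" "d \<in> set [1..14 div (k ^ 2 * z)]" "x \<in> set [1..7]"
    using k s d dle bounds \<open>k \<le> 3\<close> \<open>x \<le> 7\<close> by auto
  show ?thesis
    using reduced_search[rule_format, OF mem assms(2)[unfolded d(2)] e[unfolded d(2)]] d(2)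
    by simp
qed

text \<open>On the diagonal the equation becomes \<open>(k * X - 4) * y ^ 2 = X ^ 2\<close> with
  \<open>X = x ^ 2\<close>. Together with \<open>X \<le> 2 * y\<close> this traps
  \<open>k * X\<close> between 5 and 8, so \<open>x\<close> is 1 or 2.\<close>

lemma reduced_eq:
  assumes "sol k x y y" "x ^ 2 \<le> y + y"
  shows "k = 2 \<and> x = 2 \<and> y = 2 \<or> k = 5 \<and> x = 1 \<and> y = 1"
proof -
  define X where "X = x ^ 2"
  have s: "0 < x" "0 < y" and e: "x ^ 4 + (y + y) ^ 2 = k * x ^ 2 * y * y"
    using assms by (auto simp: sol_def)
  have X: "0 < X" "X \<le> 2 * y" using s assms by (auto simp: X_def)
  have e': "(k * X - 4) * y ^ 2 = X ^ 2"
    using e by (simp add: X_def algebra_simps power2_eq_square power4_eq_xxxx)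
  have "X ^ 2 \<le> (2 * y) ^ 2" using X by (intro power_mono) auto
  then have "(k * X - 4) * y ^ 2 \<le> 4 * y ^ 2" using e' by (simp add: power2_eq_square)
  then have le: "k * X \<le> 8" using s by simp
  have "0 < (k * X - 4) * y ^ 2" unfolding e' using X by simp
  then have gt: "4 < k * X" using s by (simp add: zero_less_mult_iff)
  then have "0 < k * X" by simp
  then have k: "0 < k" using X(1) by (rule zero_less_mult_pos2)
  have "x < 3"
  proof (rule ccontr)
    assume "\<not> x < 3"
    then have "3 ^ 2 \<le> X" unfolding X_def by (intro power_mono) auto
    then have "1 * 9 \<le> k * X" using k by (intro mult_mono) auto
    then show False using le by simp
  qed
  then consider "x = 1" | "x = 2" using s by linarith
  then show ?thesis
  proof cases
    case 1
    then have "(k - 4) * y ^ 2 = 1" using e' by (simp add: X_def)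
    then have "k - 4 = 1" "y ^ 2 = 1" using gt 1 by (auto simp: zmult_eq_1_iff X_def)
    then show ?thesis using 1 s by (auto simp: power2_eq_1_iff)
  next
    case 2
    then have "k = 2" using le gt by (simp add: X_def)
    then have "y ^ 2 = 2 ^ 2" using e' 2 by (simp add: X_def)
    then have "y = 2" using s power2_eq_imp_eq[of y 2] by simp
    then show ?thesis using 2 \<open>k = 2\<close> by simp
  qed
qed

section \<open>Descent to the base solutions\<close>

definition base :: "int \<Rightarrow> int \<Rightarrow> int \<Rightarrow> int \<Rightarrow> bool" where
  "base k x y z \<longleftrightarrow> (k, x, y, z) \<in> {(1, 3, 6, 3), (1, 3, 3, 6), (2, 2, 2, 2), (5, 1, 1, 1)}"

lemma base_if_reduced:
  assumes "sol k x y z" "x ^ 2 \<le> y + z" "y ^ 2 \<le> x ^ 4 + z ^ 2" "z ^ 2 \<le> x ^ 4 + y ^ 2"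
  shows "base k x y z"
proof (cases y z rule: linorder_cases)
  case less
  then show ?thesis
    using reduced_gt[of k x z y] assms by (auto simp: base_def sol_swap add.commute)
next
  case equal
  then show ?thesis using reduced_eq[of k x y] assms by (auto simp: base_def)
next
  case greater
  then show ?thesis using reduced_gt[of k x y z] assms by (auto simp: base_def)
qed

text \<open>Strong induction on \<open>x + y + z\<close>. If a reduction inequality fails, the old
  coordinate times its replacement is less than the square of the old one, so the matching move
  lowers the sum and stays in the orbit.\<close>

lemma base_in_orbit:
  assumes "sol k x y z"
  shows "\<exists>a b c. base k a b c \<and> Gam_orbit (pt x y z) = Gam_orbit (pt a b c)"
  using assms
proof (induction "nat (x + y + z)" arbitrary: x y z rule: less_induct)
  case less
  have s: "0 < x" "0 < y" "0 < z" using less.prems by (auto simp: sol_def)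
  have step: ?case
    if "sol k x' y' z'" "x' + y' + z' < x + y + z" "m \<in> {mu1, mu2, mu3}"
      "m (pt x y z) = pt x' y' z'" for x' y' z' m
    using less.hyps[OF _ that(1)] that s Gam_orbit_mu[OF pt_in_Qpos3[OF s] that(3)] by auto
  consider "y + z < x * x" | "x ^ 4 + z ^ 2 < y * y" | "x ^ 4 + y ^ 2 < z * z" | "base k x y z"
    using base_if_reduced[OF less.prems] unfolding power2_eq_square by linarith
  then show ?case
  proof cases
    case 1
    obtain x' where x': "x * x' = y + z" "sol k x' y z" "mu1 (pt x y z) = pt x' y z"
      using sol_mu1[OF less.prems] by metis
    then have "x' < x" using 1 s by (metis mult_less_cancel_left_pos)
    then show ?thesis using x' by (intro step[of x' y z mu1]) auto
  next
    case 2
    obtain y' where y': "y * y' = x ^ 4 + z ^ 2" "sol k x y' z" "mu2 (pt x y z) = pt x y' z"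
      using sol_mu2[OF less.prems] by metis
    then have "y' < y" using 2 s by (metis mult_less_cancel_left_pos)
    then show ?thesis using y' by (intro step[of x y' z mu2]) auto
  next
    case 3
    obtain z' where z': "z * z' = x ^ 4 + y ^ 2" "sol k x y z'" "mu3 (pt x y z) = pt x y z'"
      using sol_mu3[OF less.prems] by metis
    then have "z' < z" using 3 s by (metis mult_less_cancel_left_pos)
    then show ?thesis using z' by (intro step[of x y z' mu3]) auto
  qed auto
qed

section \<open>Separation of the two orbits for k = 1\<close>

lemma dvd_3_if_sum_squares:
  fixes a b :: int
  assumes "3 dvd a ^ 2 + b ^ 2"
  shows "3 dvd b"
proof -
  \<comment> \<open>Squares are 0 or 1 modulo 3, so a sum of two vanishes only if both do.\<close>
  have "a mod 3 \<in> {0, 1, 2}" "b mod 3 \<in> {0, 1, 2}" by auto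
  moreover have "((a mod 3) ^ 2 + (b mod 3) ^ 2) mod 3 = (a ^ 2 + b ^ 2) mod 3"
    by (rule mod_add_cong) (rule power_mod)+
  then have "((a mod 3) ^ 2 + (b mod 3) ^ 2) mod 3 = 0" using assms by simp
  ultimately show ?thesis by (elim insertE emptyE) (simp_all add: dvd_eq_mod_eq_0)
qed

text \<open>While 3 divides \<open>x\<close>, the second move acts modulo 9 as -2 z - y, sending 6
  to -12 = 6, and the third as -2 y - z, sending 3 to -15 = 3. The first move keeps 3 dividing
  \<open>x\<close> because \<open>x ^ 2 + x' ^ 2 = y * z\<close> is a multiple of 3.\<close>

lemma mod_9_invariant:
  "Gam_orbit (pt 3 6 3) \<subseteq>
    {pt x y z | x y z. sol 1 x y z \<and> 3 dvd x \<and> y mod 9 = 6 \<and> z mod 9 = 3}" (is "_ \<subseteq> ?T")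
proof (rule Gam_orbit_subset)
  show "pt 3 6 3 \<in> ?T" by (force simp: sol_def)
  show "?T \<subseteq> Qpos3" by (auto simp: sol_def intro: pt_in_Qpos3)
  fix q assume "q \<in> ?T"
  then obtain x y z where q: "q = pt x y z" "sol 1 x y z" "3 dvd x" "y mod 9 = 6" "z mod 9 = 3"
    by auto
  have "3 ^ 2 dvd x ^ 2" using q(3) by (rule dvd_power_same)
  then obtain w where w: "x ^ 2 = 9 * w" by auto
  obtain x' where x': "x ^ 2 + x' ^ 2 = 1 * y * z" "sol 1 x' y z" "mu1 q = pt x' y z"
    using sol_mu1[OF q(2)] q(1) by metis
  have "3 dvd y" using q(4) by presburger
  then have "3 dvd x'" using dvd_3_if_sum_squares[of x x'] unfolding x'(1) by simp
  then have 1: "mu1 q \<in> ?T" using x' q by auto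
  obtain y' where y': "y' = 1 * x ^ 2 * z - 2 * z - y" "sol 1 x y' z" "mu2 q = pt x y' z"
    using sol_mu2[OF q(2)] q(1) by metis
  have "y' = 9 * (w * z) - 2 * z - y" using y'(1) w by simp
  then have "y' mod 9 = 6" using q(4,5) by presburger
  then have 2: "mu2 q \<in> ?T" using y' q by auto
  obtain z' where z': "z' = 1 * x ^ 2 * y - 2 * y - z" "sol 1 x y z'" "mu3 q = pt x y z'"
    using sol_mu3[OF q(2)] q(1) by metis
  have "z' = 9 * (w * y) - 2 * y - z" using z'(1) w by simp
  then have "z' mod 9 = 3" using q(4,5) by presburger
  then have 3: "mu3 q \<in> ?T" using z' q by auto
  show "mu1 q \<in> ?T \<and> mu2 q \<in> ?T \<and> mu3 q \<in> ?T" using 1 2 3 by blast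
qed

lemma orbits_distinct: "Gam_orbit (pt 3 6 3) \<noteq> Gam_orbit (pt 3 3 6)"
proof
  assume "Gam_orbit (pt 3 6 3) = Gam_orbit (pt 3 3 6)"
  then have "pt 3 3 6 \<in> Gam_orbit (pt 3 6 3)" using mem_Gam_orbit pt_in_Qpos3 by simp
  \<comment> \<open>The second coordinate of \<open>pt 3 3 6\<close> is 3 modulo 9 instead of
    6.\<close>
  then show False using mod_9_invariant by (auto simp: pt_def)
qed

section \<open>The solution set as a union of orbits\<close>

lemma base_sol: "base k x y z \<Longrightarrow> sol k x y z"
  by (auto simp: base_def sol_def)

text \<open>Descent gives one inclusion, stability of solutions under the moves the other. For
  \<open>k\<close> outside 1, 2, 5 the union is empty, which settles the nonexistence claim.\<close>

lemma solutions_eq_orbits: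
  "pos_int_solutions k = (\<Union>(a, b, c) \<in> {(a, b, c). base (int k) a b c}. Gam_orbit (pt a b c))"
proof
  show "pos_int_solutions k \<subseteq> (\<Union>(a, b, c) \<in> {(a, b, c). base (int k) a b c}. Gam_orbit (pt a b c))"
  proof
    fix p assume "p \<in> pos_int_solutions k"
    then obtain x y z where p: "p = pt x y z" "sol (int k) x y z"
      by (auto simp: pos_int_solutions_iff)
    then have "p \<in> Gam_orbit (pt x y z)"
      by (auto simp: sol_def intro: mem_Gam_orbit pt_in_Qpos3)
    then show "p \<in> (\<Union>(a, b, c) \<in> {(a, b, c). base (int k) a b c}. Gam_orbit (pt a b c))"
      using base_in_orbit[OF p(2)] by blast
  qed
  have "Gam_orbit (pt a b c) \<subseteq> pos_int_solutions k" if "base (int k) a b c" for a b c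
    using Gam_orbit_subset_solutions base_sol[OF that] pos_int_solutions_iff by blast
  then show "(\<Union>(a, b, c) \<in> {(a, b, c). base (int k) a b c}. Gam_orbit (pt a b c)) \<subseteq> pos_int_solutions k"
    by auto
qed

theorem theorem1p4:
  fixes k :: nat
  shows "(pos_int_solutions k \<noteq> {} \<longleftrightarrow> k = 1 \<or> k = 2 \<or> k = 5) \<and>
    (k = 1 \<longrightarrow>
       pos_int_solutions k = Gam_orbit (3, 6, 3) \<union> Gam_orbit (3, 3, 6) \<and>
       Gam_orbit (3, 6, 3) \<noteq> Gam_orbit (3, 3, 6)) \<and>
    (k = 2 \<longrightarrow> pos_int_solutions k = Gam_orbit (2, 2, 2)) \<and>
    (k = 5 \<longrightarrow> pos_int_solutions k = Gam_orbit (1, 1, 1))"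
proof -
  have 1: "{(a, b, c). base (int 1) a b c} = {(3, 6, 3), (3, 3, 6)}"
    and 2: "{(a, b, c). base (int 2) a b c} = {(2, 2, 2)}"
    and 5: "{(a, b, c). base (int 5) a b c} = {(1, 1, 1)}"
    by (auto simp: base_def)
  have "pos_int_solutions 1 = Gam_orbit (3, 6, 3) \<union> Gam_orbit (3, 3, 6)"
    unfolding solutions_eq_orbits 1 by (simp add: pt_def)
  moreover have "pos_int_solutions 2 = Gam_orbit (2, 2, 2)"
    unfolding solutions_eq_orbits 2 by (simp add: pt_def)
  moreover have "pos_int_solutions 5 = Gam_orbit (1, 1, 1)"
    unfolding solutions_eq_orbits 5 by (simp add: pt_def)
  \<comment> \<open>These memberships make the three solution sets nonempty.\<close>
  moreover have "(3, 6, 3) \<in> Gam_orbit (3, 6, 3)" "(2, 2, 2) \<in> Gam_orbit (2, 2, 2)"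
    "(1, 1, 1) \<in> Gam_orbit (1, 1, 1)"
    by (auto intro!: mem_Gam_orbit simp: Qpos3_def)
  moreover have "k = 1 \<or> k = 2 \<or> k = 5" if "pos_int_solutions k \<noteq> {}"
    using that unfolding solutions_eq_orbits by (auto simp: base_def)
  moreover have "Gam_orbit (3, 6, 3) \<noteq> Gam_orbit (3, 3, 6)"
    using orbits_distinct by (simp add: pt_def)
  ultimately show ?thesis by blast
qed

end
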